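(* The maps $\mathrm{Join}$ and $\mathrm{Split}$ are mutually inverse bijections between $\mathrm{IPF}^*$ (finite lists of increasing parking functions, identified up to appending or removing trailing empty lists) and the set of finite weakly increasing sequences of positive integers.
   Context: An increasing parking function (IPF) of length $\ell\ge 0$ is a weakly increasing sequence $(a_1,\dots,a_\ell)$ of positive integers with $a_j\le j$ for all $j$ (the empty sequence is an IPF). $\mathrm{IPF}^*$ is the set of finite lists $(\mathbf{a}^{(1)},\dots,\mathbf{a}^{(r)})$ of IPFs of arbitrary (possibly zero, possibly different) lengths; such a list is regarded as an infinite list in which all entries after the $r$-th are empty, so lists differing only by trailing empty IPFs are identified. For a list $\mathbf{a}=(a_1,\dots,a_k)$ and integer $x$, write $\mathbf{a}\oplus x=(a_1+x,\dots,a_k+x)$, $\mathbf{a}\ominus x=(a_1-x,\dots,a_k-x)$, and $\bullet$ for concatenation. $\mathrm{Join}$: given $(\mathbf{a}^{(1)},\dots,\mathbf{a}^{(r)})\in\mathrm{IPF}^*$, let $\ell_i=|\mathbf{a}^{(i)}|$, $L_i=\ell_1+\dots+\ell_i$, $L_0=0$, and $\mathbf{b}^{(i)}=\mathbf{a}^{(i)}\oplus(L_{i-1}+i-1)$; then $\mathrm{Join}(\mathbf{a}^{(1)},\dots,\mathbf{a}^{(r)})=\mathbf{b}^{(1)}\bullet\cdots\bullet\mathbf{b}^{(r)}$. $\mathrm{Split}$: for a weakly increasing sequence $\mathbf{p}$ of positive integers, $\mathrm{Split}(())=()$; otherwise let $\mathbf{a}$ be the longest prefix of $\mathbf{p}$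 that is an IPF (possibly empty) and write $\mathbf{p}=\mathbf{a}\bullet\mathbf{q}$; if $\mathbf{q}$ is empty then $\mathrm{Split}(\mathbf{p})=(\mathbf{a})$, and otherwise $\mathrm{Split}(\mathbf{p})$ is the list $\mathbf{a}$ followed by the entries of $\mathrm{Split}(\mathbf{q}\ominus(|\mathbf{a}|+1))$. *)

theory Defs
  imports Main
begin

definition is_ipf :: "int list \<Rightarrow> bool" where
  "is_ipf a \<longleftrightarrow> sorted a \<and> (\<forall>x\<in>set a. 0 < x) \<and> (\<forall>j<length a. a ! j \<le> int (j + 1))"

definition weakly_increasing_pos :: "int list set" where
  "weakly_increasing_pos = {p. sorted p \<and> (\<forall>x\<in>set p. 0 < x)}"

definition ipf_lists :: "int list list set" where
  "ipf_lists = {as. \<forall>a\<in>set as. is_ipf a}"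

definition trailing_eq :: "int list list rel" where
  "trailing_eq = {(as, bs). as \<in> ipf_lists \<and> bs \<in> ipf_lists \<and>
     (\<exists>m n. as @ replicate m [] = bs @ replicate n [])}"

lemma equiv_trailing_eq: "equiv ipf_lists trailing_eq"
proof (rule equivI)
  show "trailing_eq \<subseteq> ipf_lists \<times> ipf_lists"
    by (auto simp: trailing_eq_def)
  show "refl_on ipf_lists trailing_eq"
    by (auto simp: refl_on_def trailing_eq_def)
  show "sym trailing_eq"
    unfolding sym_def trailing_eq_def by (auto, metis)
  show "trans trailing_eq"
  proof (rule transI)
    fix as bs cs
    assume "(as, bs) \<in> trailing_eq" "(bs, cs) \<in> trailing_eq"
    then obtain m n k l where
      in_lists: "as \<in> ipf_lists" "cs \<in> ipf_lists" and
      eqs: "as @ replicate m [] = bs @ replicate n []" "bs @ replicate k [] = cs @ replicate l []"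
      by (auto simp: trailing_eq_def)
    have "as @ replicate (m + k) [] = (as @ replicate m []) @ replicate k []"
      by (simp add: replicate_add)
    also have "\<dots> = bs @ replicate (n + k) []"
      using eqs(1) by (simp add: replicate_add)
    also have "\<dots> = (bs @ replicate k []) @ replicate n []"
      by (simp add: replicate_add [symmetric] add.commute)
    also have "\<dots> = cs @ replicate (l + n) []"
      using eqs(2) by (simp add: replicate_add)
    finally show "(as, cs) \<in> trailing_eq"
      using in_lists by (auto simp: trailing_eq_def)
  qed
qed

definition ipf_star :: "int list list set set" where
  "ipf_star = ipf_lists // trailing_eq"

definition shift_up :: "int list \<Rightarrow> int \<Rightarrow> int list" (infixl "\<oplus>" 70) where
  "a \<oplus> x = map (\<lambda>y. y + x) a"

definition shift_down :: "int list \<Rightarrow> int \<Rightarrow> int list" (infixl "\<ominus>" 70) where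
  "a \<ominus> x = map (\<lambda>y. y - x) a"

text \<open>Blocks are indexed from 0, so block \<open>i\<close> here is the paper's block \<open>i + 1\<close>, whose
  offset is \<open>L\<^sub>i + i\<close>.\<close>

definition total_length :: "int list list \<Rightarrow> nat \<Rightarrow> nat" where
  "total_length as i = (\<Sum>j<i. length (as ! j))"

definition join_list :: "int list list \<Rightarrow> int list" where
  "join_list as = concat (map (\<lambda>i. as ! i \<oplus> int (total_length as i + i)) [0..<length as])"

definition longest_ipf_prefix :: "int list \<Rightarrow> int list" where
  "longest_ipf_prefix p = take (GREATEST k. k \<le> length p \<and> is_ipf (take k p)) p"

lemma sum_list_shift_down_less:
  assumes "q \<noteq> []" "\<forall>x\<in>set q. 0 < x" "0 < c"
  shows "(\<Sum>x\<leftarrow>q \<ominus> c. nat x) < (\<Sum>x\<leftarrow>q. nat x)"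
  using assms
proof (induction q rule: list_nonempty_induct)
  case (single x)
  then show ?case by (simp add: shift_down_def)
next
  case (cons x xs)
  have "nat (x - c) < nat x"
    using cons.prems by simp
  then show ?case
    using cons by (simp add: shift_down_def)
qed

text \<open>Outside \<^const>\<open>weakly_increasing_pos\<close> the recursion need not terminate (with a nonpositive
  first entry the longest prefix stays empty forever), so the function is cut off there.\<close>

function split_list :: "int list \<Rightarrow> int list list" where
  "split_list p =
    (if p \<notin> weakly_increasing_pos \<or> p = [] then []
     else let a = longest_ipf_prefix p; q = drop (length a) p
          in if q = [] then [a] else a # split_list (q \<ominus> int (length a + 1)))"
  by pat_completeness auto
termination
proof (relation "measure (\<lambda>p. \<Sum>x\<leftarrow>p. nat x)", goal_cases)
  case 1
  show ?case by simp
next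
  case (2 p a q)
  have pos: "\<forall>x\<in>set q. 0 < x"
    using 2 by (auto simp: weakly_increasing_pos_def dest: in_set_dropD)
  have "(\<Sum>x\<leftarrow>q \<ominus> int (length a + 1). nat x) < (\<Sum>x\<leftarrow>q. nat x)"
    using sum_list_shift_down_less [OF _ pos] 2 by simp
  also have "\<dots> \<le> (\<Sum>x\<leftarrow>take (length a) p. nat x) + (\<Sum>x\<leftarrow>q. nat x)"
    by simp
  also have "\<dots> = (\<Sum>x\<leftarrow>take (length a) p @ drop (length a) p. nat x)"
    using 2 by (simp only: map_append sum_list_append)
  also have "\<dots> = (\<Sum>x\<leftarrow>p. nat x)"
    by simp
  finally show ?case by simp
qed

declare split_list.simps [simp del]

text \<open>The induced maps on equivalence classes; \<open>Join\<close> is meaningful because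
  \<^const>\<open>join_list\<close> is constant on each class.\<close>

definition Join :: "int list list set \<Rightarrow> int list" where
  "Join c = the_elem (join_list ` c)"

definition Split :: "int list \<Rightarrow> int list list set" where
  "Split p = trailing_eq `` {split_list p}"

end

theory Submission
  imports Defs
begin

text \<open>Joining satisfies the recursion \<open>Join (a, as) = a \<bullet> (Join as \<oplus> (|a| + 1))\<close>, and this undoes
  one step of \<open>Split\<close>: the entries of the shifted tail exceed \<open>|a| + 1\<close>, so none of them can
  extend \<open>a\<close> to a longer parking function, and \<open>a\<close> is recovered as the longest parking-function
  prefix. Conversely, maximality of that prefix forces every remaining entry above \<open>|a| + 1\<close>, so
  the shifted-down remainder is again weakly increasing and positive.\<close>

section \<open>Increasing parking functions and shifts\<close>

lemma is_ipf_Nil [simp]: "is_ipf []"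
  by (simp add: is_ipf_def)

lemma is_ipf_le_length:
  assumes "is_ipf a" "x \<in> set a"
  shows "x \<le> int (length a)"
  using assms unfolding is_ipf_def in_set_conv_nth by fastforce

lemma is_ipf_snoc:
  assumes "is_ipf a" "sorted (a @ [x])" "0 < x" "x \<le> int (length a + 1)"
  shows "is_ipf (a @ [x])"
  using assms unfolding is_ipf_def by (auto simp: nth_append less_Suc_eq)

lemma set_shift_up: "set (a \<oplus> c) = (\<lambda>x. x + c) ` set a"
  by (simp add: shift_up_def)

lemma shift_up_shift_down [simp]: "(a \<ominus> c) \<oplus> c = a"
  by (simp add: shift_up_def shift_down_def comp_def)

lemma shift_down_shift_up [simp]: "(a \<oplus> c) \<ominus> c = a"
  by (simp add: shift_up_def shift_down_def comp_def)

lemma shift_up_eq_Nil_iff [simp]: "a \<oplus> c = [] \<longleftrightarrow> a = []"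
  by (simp add: shift_up_def)

lemma shift_down_eq_Nil_iff [simp]: "a \<ominus> c = [] \<longleftrightarrow> a = []"
  by (simp add: shift_down_def)

lemma sorted_shift_up [simp]: "sorted (a \<oplus> c) \<longleftrightarrow> sorted a"
  by (simp add: shift_up_def sorted_map)

lemma sorted_shift_down [simp]: "sorted (a \<ominus> c) \<longleftrightarrow> sorted a"
  by (simp add: shift_down_def sorted_map)

section \<open>Recursion and range of Join\<close>

lemma join_list_Nil [simp]: "join_list [] = []"
  by (simp add: join_list_def)

text \<open>Prepending \<open>a\<close> raises the index of every later block by 1 and its preceding
  total length by \<open>length a\<close>, so all later offsets grow by the same constant.\<close>

lemma join_list_Cons: "join_list (a # as) = a @ (join_list as \<oplus> int (length a + 1))"
proof -
  have total: "total_length (a # as) (Suc i) = length a + total_length as i" for i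
    by (simp add: total_length_def sum.lessThan_Suc_shift del: sum.lessThan_Suc)
  have "[0..<length (a # as)] = 0 # map Suc [0..<length as]"
    by (simp add: map_Suc_upt upt_conv_Cons del: upt_Suc)
  then show ?thesis
    unfolding join_list_def
    by (simp add: total total_length_def [of _ 0] map_concat shift_up_def comp_def algebra_simps)
qed

lemma join_list_replicate_Nil [simp]: "join_list (replicate m []) = []"
  by (induction m) (simp_all add: join_list_Cons shift_up_def)

lemma join_list_append_replicate_Nil: "join_list (as @ replicate m []) = join_list as"
  by (induction as) (simp_all add: join_list_Cons)

text \<open>Detects when a tail consists of empty blocks only, which is the information that
  splitting cannot recover.\<close>

lemma join_list_eq_Nil_iff: "join_list as = [] \<longleftrightarrow> as = replicate (length as) []"
  by (induction as) (auto simp: join_list_Cons)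

lemma join_list_respects: "join_list respects trailing_eq"
  by (auto simp: congruent_def trailing_eq_def) (metis join_list_append_replicate_Nil)

lemma join_list_mem:
  assumes "as \<in> ipf_lists"
  shows "join_list as \<in> weakly_increasing_pos"
  using assms
proof (induction as)
  case Nil
  show ?case by (simp add: weakly_increasing_pos_def)
next
  case (Cons a as)
  have a: "is_ipf a" and IH: "join_list as \<in> weakly_increasing_pos"
    using Cons by (auto simp: ipf_lists_def)
  \<comment> \<open>Sortedness across the seam: \<open>x\<close> is at most \<open>length a\<close>,
    and \<open>y\<close> is positive.\<close>
  have "x \<le> y + int (length a + 1)" if "x \<in> set a" "y \<in> set (join_list as)" for x y
    using is_ipf_le_length [OF a that(1)] IH that(2) by (force simp: weakly_increasing_pos_def)
  then show ?case
    using a IH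
    by (auto simp: join_list_Cons weakly_increasing_pos_def sorted_append set_shift_up is_ipf_def
        intro: add_pos_nonneg)
qed

section \<open>The longest parking-function prefix\<close>

lemma longest_ipf_prefix_append:
  assumes a: "is_ipf a" and b: "\<forall>x\<in>set b. int (length a + 1) < x"
  shows "longest_ipf_prefix (a @ b) = a"
proof -
  have "k \<le> length a" if k: "k \<le> length (a @ b)" "is_ipf (take k (a @ b))" for k
  proof (rule ccontr)
    assume "\<not> k \<le> length a"
    then have less: "length a < k" by simp
    \<comment> \<open>Index \<open>length a\<close>, counted from 0, carries the bound
      \<open>length a + 1\<close>; the entry there is the first one of \<open>b\<close>.\<close>
    then have "take k (a @ b) ! length a \<le> int (length a + 1)"
      using k unfolding is_ipf_def by simp
    moreover have "take k (a @ b) ! length a \<in> set b"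
      using less k(1) by (cases b) (auto simp: nth_append)
    ultimately show False
      using b by fastforce
  qed
  then have "(GREATEST k. k \<le> length (a @ b) \<and> is_ipf (take k (a @ b))) = length a"
    by (intro Greatest_equality) (use a in auto)
  then show ?thesis
    by (simp add: longest_ipf_prefix_def)
qed

lemma longest_ipf_prefix_decompose:
  assumes p: "p \<in> weakly_increasing_pos"
  obtains a q where "longest_ipf_prefix p = a" "p = a @ q" "is_ipf a"
    "\<forall>x\<in>set q. int (length a + 1) < x"
proof -
  let ?P = "\<lambda>k. k \<le> length p \<and> is_ipf (take k p)"
  define k where "k = (GREATEST k. ?P k)"
  have bound: "\<And>j. ?P j \<Longrightarrow> j \<le> length p" by simp
  \<comment> \<open>The maximum exists: the empty prefix qualifies and \<open>length p\<close>
    bounds all candidates.\<close>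
  have k: "?P k"
    unfolding k_def by (rule GreatestI_nat [where b = "length p" and k = 0]) auto
  have max: "j \<le> k" if "?P j" for j
    unfolding k_def by (rule Greatest_le_nat [of ?P, OF that bound])
  have sorted_q: "sorted (drop k p)"
    using p by (simp add: weakly_increasing_pos_def sorted_wrt_drop)
  have "int (k + 1) < x" if x: "x \<in> set (drop k p)" for x
  proof -
    have k_less: "k < length p"
      using x by (cases "k < length p") auto
    have take_Suc: "take (Suc k) p = take k p @ [p ! k]"
      using k_less by (rule take_Suc_conv_app_nth)
    \<comment> \<open>Only the first leftover entry needs maximality, since otherwise it could be
      appended to the prefix; sortedness passes the bound on to the later entries.\<close>
    have "int (k + 1) < p ! k"
    proof (rule ccontr)
      assume "\<not> int (k + 1) < p ! k"
      moreover have "sorted (take (Suc k) p)" "0 < p ! k"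
        using p k_less by (simp_all add: weakly_increasing_pos_def sorted_wrt_take)
      ultimately have "is_ipf (take (Suc k) p)"
        using k k_less unfolding take_Suc by (intro is_ipf_snoc) auto
      then show False
        using max [of "Suc k"] k_less by simp
    qed
    moreover have "p ! k \<le> x"
      using sorted_q x k_less by (auto simp: Cons_nth_drop_Suc [symmetric])
    ultimately show ?thesis by simp
  qed
  then show thesis
    using that [of "take k p" "drop k p"] k
    by (simp add: longest_ipf_prefix_def k_def min_absorb2)
qed

section \<open>Recursion and induction for Split\<close>

lemma split_list_Nil [simp]: "split_list [] = []"
  by (subst split_list.simps) simp

text \<open>The empty sequence is set apart because it splits into \<open>[]\<close>, not into
  \<open>[[]]\<close>.\<close>

lemma split_list_ipf: "split_list a = [a]" if "is_ipf a" "a \<noteq> []"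
  using that longest_ipf_prefix_append [of a "[]"]
  by (subst split_list.simps) (auto simp: is_ipf_def weakly_increasing_pos_def)

text \<open>A nonempty \<open>r\<close> leads to the recursive branch, where shifting down cancels
  the shift up.\<close>

lemma split_list_append:
  assumes "is_ipf a" "r \<noteq> []" "a @ (r \<oplus> int (length a + 1)) \<in> weakly_increasing_pos"
    "\<forall>x\<in>set r. 0 < x"
  shows "split_list (a @ (r \<oplus> int (length a + 1))) = a # split_list r"
proof -
  have "longest_ipf_prefix (a @ (r \<oplus> int (length a + 1))) = a"
    using assms by (intro longest_ipf_prefix_append) (auto simp: set_shift_up)
  then show ?thesis
    using assms by (subst split_list.simps) (simp add: Let_def del: of_nat_add)
qed

text \<open>Recasts \<open>split_list.induct\<close> with the remainder written as a shifted-up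
  \<open>r\<close>, the form to which \<open>split_list_append\<close> and
  \<open>join_list_Cons\<close> apply directly.\<close>

lemma weakly_increasing_pos_induct [consumes 1, case_names ipf append]:
  assumes "p \<in> weakly_increasing_pos"
    and ipf: "\<And>a. is_ipf a \<Longrightarrow> P a"
    and append: "\<And>a r. is_ipf a \<Longrightarrow> r \<noteq> [] \<Longrightarrow> r \<in> weakly_increasing_pos \<Longrightarrow>
      a @ (r \<oplus> int (length a + 1)) \<in> weakly_increasing_pos \<Longrightarrow> P r \<Longrightarrow>
      P (a @ (r \<oplus> int (length a + 1)))"
  shows "P p"
  using assms(1)
proof (induction p rule: split_list.induct)
  case (1 p)
  obtain a q where a: "longest_ipf_prefix p = a" "p = a @ q" "is_ipf a"
    and q: "\<forall>x\<in>set q. int (length a + 1) < x"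
    using longest_ipf_prefix_decompose [OF 1(2)] .
  show ?case
  proof (cases "q = []")
    case True
    with a ipf show ?thesis by simp
  next
    case False
    let ?r = "q \<ominus> int (length a + 1)"
    have r: "?r \<in> weakly_increasing_pos"
      using 1(2) a(2) q
      by (auto simp: weakly_increasing_pos_def sorted_append) (auto simp: shift_down_def)
    have "drop (length a) p = q" "\<not> (p \<notin> weakly_increasing_pos \<or> p = [])"
      using 1(2) a(2) False by auto
    then have "P ?r"
      using 1(1) [of a q] a(1) False r by simp
    then show ?thesis
      using append [of a ?r] a False r 1(2) by simp
  qed
qed

section \<open>Inverse laws on lists\<close>

lemma split_list_mem:
  assumes "p \<in> weakly_increasing_pos"
  shows "split_list p \<in> ipf_lists"
  using assms
proof (induction rule: weakly_increasing_pos_induct)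
  case (ipf a)
  then show ?case by (cases "a = []") (auto simp: split_list_ipf ipf_lists_def)
next
  case (append a r)
  then have "split_list (a @ (r \<oplus> int (length a + 1))) = a # split_list r"
    by (intro split_list_append) (auto simp: weakly_increasing_pos_def)
  then show ?case using append by (simp add: ipf_lists_def)
qed

lemma join_list_split_list:
  assumes "p \<in> weakly_increasing_pos"
  shows "join_list (split_list p) = p"
  using assms
proof (induction rule: weakly_increasing_pos_induct)
  case (ipf a)
  then show ?case by (cases "a = []") (auto simp: split_list_ipf join_list_Cons)
next
  case (append a r)
  then have "split_list (a @ (r \<oplus> int (length a + 1))) = a # split_list r"
    by (intro split_list_append) (auto simp: weakly_increasing_pos_def)
  then show ?case using append by (simp add: join_list_Cons)
qed

text \<open>Splitting stops once the remainder is empty, so trailing empty blocks are lost, while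
  empty blocks before a nonempty one survive.\<close>

lemma split_list_join_list_append_Nil:
  assumes "as \<in> ipf_lists"
  shows "\<exists>n. as = split_list (join_list as) @ replicate n []"
  using assms
proof (induction as)
  case (Cons a as)
  then have a: "is_ipf a" and as: "as \<in> ipf_lists"
    by (auto simp: ipf_lists_def)
  show ?case
  proof (cases "join_list as = []")
    case True
    then have "join_list (a # as) = a" and Nil: "as = replicate (length as) []"
      by (simp_all add: join_list_Cons flip: join_list_eq_Nil_iff)
    then show ?thesis
    proof (cases "a = []")
      case True
      \<comment> \<open>Here the head is lost too, so \<open>n\<close> is
        \<open>Suc (length as)\<close>; with a nonempty head it is \<open>length as\<close>.\<close>
      then have "a # as = replicate (Suc (length as)) []"
        using Nil by simp
      then show ?thesis
        using True \<open>join_list (a # as) = a\<close> by (metis append_Nil split_list_Nil)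
    next
      case False
      then show ?thesis
        using Nil a \<open>join_list (a # as) = a\<close> by (auto simp: split_list_ipf)
    qed
  next
    case False
    then have "split_list (join_list (a # as)) = a # split_list (join_list as)"
      using join_list_mem [OF Cons.prems] join_list_mem [OF as] a unfolding join_list_Cons
      by (intro split_list_append) (auto simp: weakly_increasing_pos_def)
    \<comment> \<open>The head is recovered, so \<open>n\<close> is inherited from the tail.\<close>
    then show ?thesis
      using Cons.IH [OF as] by simp
  qed
qed simp

lemma split_list_join_list:
  assumes "as \<in> ipf_lists"
  shows "(as, split_list (join_list as)) \<in> trailing_eq"
proof -
  obtain n where "as = split_list (join_list as) @ replicate n []"
    using split_list_join_list_append_Nil [OF assms] ..
  then have "as @ replicate 0 [] = split_list (join_list as) @ replicate n []"
    by simp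
  then show ?thesis
    using assms split_list_mem [OF join_list_mem] unfolding trailing_eq_def by blast
qed

section \<open>Passage to equivalence classes\<close>

lemma Join_class:
  assumes "as \<in> ipf_lists"
  shows "Join (trailing_eq `` {as}) = join_list as"
proof -
  have "as \<in> trailing_eq `` {as}"
    using equiv_class_self [OF equiv_trailing_eq assms] .
  moreover have "join_list bs = join_list as" if "bs \<in> trailing_eq `` {as}" for bs
    using congruentD [OF join_list_respects, of as bs] that by simp
  \<comment> \<open>Constancy on the class makes the image a singleton, so \<open>the_elem\<close>
    returns its value.\<close>
  ultimately have "join_list ` (trailing_eq `` {as}) = {join_list as}"
    by blast
  then show ?thesis
    by (simp add: Join_def)
qed

lemma Join_Split:
  assumes "p \<in> weakly_increasing_pos"
  shows "Join (Split p) = p"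
  using assms by (simp add: Split_def Join_class split_list_mem join_list_split_list)

lemma Split_Join:
  assumes "c \<in> ipf_star"
  shows "Split (Join c) = c"
proof -
  obtain as where as: "as \<in> ipf_lists" "c = trailing_eq `` {as}"
    using assms unfolding ipf_star_def by (rule quotientE)
  then show ?thesis
    using equiv_class_eq [OF equiv_trailing_eq split_list_join_list [OF as(1)]]
    by (metis Split_def Join_class)
qed

theorem theorem3p4:
  shows "join_list respects trailing_eq
    \<and> bij_betw Join ipf_star weakly_increasing_pos
    \<and> bij_betw Split weakly_increasing_pos ipf_star
    \<and> (\<forall>c\<in>ipf_star. Split (Join c) = c)
    \<and> (\<forall>p\<in>weakly_increasing_pos. Join (Split p) = p)"
proof -
  have Join: "Join ` ipf_star \<subseteq> weakly_increasing_pos"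
    by (auto simp: ipf_star_def Join_class join_list_mem elim!: quotientE)
  have Split: "Split ` weakly_increasing_pos \<subseteq> ipf_star"
    by (auto simp: ipf_star_def Split_def split_list_mem intro: quotientI)
  have "bij_betw Join ipf_star weakly_increasing_pos"
    using Split_Join Join_Split Join Split by (intro bij_betw_byWitness [where f' = Split]) auto
  moreover have "bij_betw Split weakly_increasing_pos ipf_star"
    using Split_Join Join_Split Join Split by (intro bij_betw_byWitness [where f' = Join]) auto
  ultimately show ?thesis
    using join_list_respects Split_Join Join_Split by blast
qed

end
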